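(* Let $(\Omega,\mathcal{A},\mathbb{P})$ be a Lebesgue probability space and $T:\Omega\to\Omega$ an invertible bimeasurable transformation preserving $\mathbb{P}$ and ergodic. Let $(X,d)$ be a proper $CAT(0)$ metric space with base point $x_0$, let $G$ be a second countable locally compact Hausdorff topological group acting continuously by isometries on $X$, and let $g:\Omega\to G$ be measurable with $\int_\Omega d(x_0,g(\omega)x_0)\,d\mathbb{P}(\omega)<\infty$. Put $Z_n(\omega)=g(\omega)g(T\omega)\cdots g(T^{n-1}\omega)$ and let $\alpha$ be the almost sure limit of $\frac1n d(x_0,Z_n(\omega)x_0)$. Assume $\alpha>0$. For $\mathbb{P}$-almost every $\omega$ let $h_\omega\in\partial X$ be such that $\lim_{n\to\infty}-\frac1n h_\omega(Z_n(\omega)x_0)=\alpha$. Then for $\mathbb{P}$-almost every $\omega$, $$\lim_{n\to\infty}\frac1n d\big(Z_n(\omega)x_0,\sigma_{h_\omega}(\alpha n)\big)=0.$$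
   Context: Proper: closed bounded subsets are compact. $CAT(0)$: geodesic metric space whose geodesic triangles are no thicker than Euclidean comparison triangles. For $x\in X$ let $\Phi_x(z)=d(x,z)-d(x,x_0)$. Identifying $x$ with $\Phi_x$, the metric compactification $\overline{X}$ is the closure of $X$ in the topology of uniform convergence on compact subsets of $X$, and $\partial X=\overline{X}\setminus X$; its elements are called horofunctions (Busemann functions in the $CAT(0)$ case). In a proper $CAT(0)$ space, for each $h\in\partial X$ there is a unique (unit speed) geodesic ray $\sigma_h:[0,\infty)\to X$ with $\sigma_h(0)=x_0$ and $\lim_{t\to\infty}\Phi_{\sigma_h(t)}=h$. The limit $\alpha$ exists and is constant almost surely (by subadditivity and ergodicity), and horofunctions $h_\omega$ as in the claim exist for almost every $\omega$ by the ergodic theorem for isometries of proper metric spaces. *)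

theory Defs
  imports "HOL-Analysis.Analysis" "HOL-Probability.Probability" "HOL-Algebra.Group_Action"
begin

definition measure_iso :: "'a measure \<Rightarrow> 'b measure \<Rightarrow> ('a \<Rightarrow> 'b) \<Rightarrow> bool" where
  "measure_iso M N f \<longleftrightarrow>
     bij_betw f (space M) (space N) \<and>
     f \<in> measurable M N \<and>
     the_inv_into (space M) f \<in> measurable N M \<and>
     distr M N f = N"

definition isomorphic_mod_0 :: "'a measure \<Rightarrow> 'b measure \<Rightarrow> bool" where
  "isomorphic_mod_0 M N \<longleftrightarrow>
     (\<exists>A B f. A \<in> sets M \<and> B \<in> sets N \<and>
        space M - A \<in> null_sets M \<and> space N - B \<in> null_sets N \<and>
        measure_iso (restrict_space M A) (restrict_space N B) f)"

text \<open>
  The disjoint union of the interval \<open>[0, s]\<close> with Lebesgue measure and of countably many points,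
  realised as \<open>-1, -2, \<dots>\<close>, of masses \<open>m 0, m 1, \<dots>\<close>. The remaining real numbers form a
  null set; so do the points of mass 0, which allows for finitely many atoms.
\<close>

definition interval_with_atoms :: "real \<Rightarrow> (nat \<Rightarrow> real) \<Rightarrow> real measure" where
  "interval_with_atoms s m = completion (measure_of UNIV (sets borel)
     (\<lambda>A. emeasure lborel (A \<inter> {0..s}) +
          (\<Sum>n. ennreal (m n) * indicator A (- 1 - real n))))"

text \<open>
  Taking the completion of \<open>M\<close> leaves a complete space unchanged and additionally
  admits standard Borel probability spaces that have not been completed.
\<close>

definition lebesgue_prob_space :: "'a measure \<Rightarrow> bool" where
  "lebesgue_prob_space M \<longleftrightarrow>
     prob_space M \<and>
     (\<exists>s m. 0 \<le> s \<and> (\<forall>n. 0 \<le> m n) \<and> m sums (1 - s) \<and>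
        isomorphic_mod_0 (completion M) (interval_with_atoms s m))"

definition ergodic_map :: "'a measure \<Rightarrow> ('a \<Rightarrow> 'a) \<Rightarrow> bool" where
  "ergodic_map M T \<longleftrightarrow>
     (\<forall>A\<in>sets M. T -` A \<inter> space M = A \<longrightarrow> measure M A = 0 \<or> measure M A = 1)"

text \<open>
  The set function in \<open>interval_with_atoms\<close> is countably additive, so that \<open>measure_of\<close> does not
  degenerate to the zero measure.
\<close>

lemma emeasure_interval_with_atoms:
  assumes "A \<in> sets borel"
  shows "emeasure (interval_with_atoms s m) A =
           emeasure lborel (A \<inter> {0..s}) + (\<Sum>n. ennreal (m n) * indicator A (- 1 - real n))"
proof -
  let ?f = "\<lambda>A. emeasure lborel (A \<inter> {0..s}) + (\<Sum>n. ennreal (m n) * indicator A (- 1 - real n))"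
  let ?N = "measure_of UNIV (sets borel) ?f"
  have sN: "sets ?N = sets borel"
    using sets.sigma_sets_eq[of "borel :: real measure"] by simp
  have "emeasure ?N A = ?f A"
  proof (rule emeasure_measure_of[OF refl])
    show "positive (sets ?N) ?f" by (simp add: positive_def)
    show "countably_additive (sets ?N) ?f"
      unfolding sN
    proof (rule countably_additiveI)
      fix B :: "nat \<Rightarrow> real set"
      assume B: "range B \<subseteq> sets borel" "disjoint_family B"
      have 1: "(\<Sum>i. emeasure lborel (B i \<inter> {0..s})) = emeasure lborel ((\<Union>i. B i) \<inter> {0..s})"
        using B by (subst suminf_emeasure) (auto simp: disjoint_family_on_def)
      have "(\<Sum>i. \<Sum>n. ennreal (m n) * indicator (B i) (- 1 - real n)) =
            (\<Sum>n. \<Sum>i. ennreal (m n) * indicator (B i) (- 1 - real n))"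
        using nn_integral_suminf[of "\<lambda>i n. ennreal (m n) * indicator (B i) (- 1 - real n)"
                                    "count_space UNIV"]
        by (simp add: nn_integral_count_space_nat)
      also have "\<dots> = (\<Sum>n. ennreal (m n) * indicator (\<Union>i. B i) (- 1 - real n))"
        by (simp only: ennreal_suminf_cmult suminf_indicator[OF B(2)])
      finally have 2: "(\<Sum>i. \<Sum>n. ennreal (m n) * indicator (B i) (- 1 - real n)) =
            (\<Sum>n. ennreal (m n) * indicator (\<Union>i. B i) (- 1 - real n))" .
      have "(\<Sum>i. ?f (B i)) =
            (\<Sum>i. emeasure lborel (B i \<inter> {0..s})) +
            (\<Sum>i. \<Sum>n. ennreal (m n) * indicator (B i) (- 1 - real n))"
        by (rule suminf_add[symmetric]) (rule summableI)+
      then show "(\<Sum>i. ?f (B i)) = ?f (\<Union>i. B i)"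
        by (simp only: 1 2)
    qed
    show "A \<in> sets ?N" using assms by (simp only: sN)
  qed simp
  moreover have "A \<in> sets ?N" using assms by (simp only: sN)
  ultimately show ?thesis
    unfolding interval_with_atoms_def by (simp only: emeasure_completion[OF sets_completionI_sets] main_part)
qed

text \<open>Geodesics are parametrised by arc length on \<open>[0, dist x y]\<close>; values elsewhere are irrelevant.\<close>

definition geodesic_from_to :: "(real \<Rightarrow> 'x::metric_space) \<Rightarrow> 'x \<Rightarrow> 'x \<Rightarrow> bool" where
  "geodesic_from_to c x y \<longleftrightarrow>
     c 0 = x \<and> c (dist x y) = y \<and>
     (\<forall>s\<in>{0..dist x y}. \<forall>t\<in>{0..dist x y}. dist (c s) (c t) = \<bar>s - t\<bar>)"

definition geodesic_space :: "'x::metric_space itself \<Rightarrow> bool" where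
  "geodesic_space _ \<longleftrightarrow> (\<forall>x y::'x. \<exists>c. geodesic_from_to c x y)"

text \<open>
  A geodesic triangle with vertices \<open>p, q, r\<close> has a comparison triangle with vertices
  \<open>p', q', r'\<close> in the Euclidean plane. The comparison inequality is demanded of points on the two
  sides issuing from \<open>p\<close>; as \<open>p, q, r\<close> range over all triples, this covers every pair of
  distinct sides, and two points on the same side have the distance of their comparison points
  anyway.
\<close>

definition CAT0_space :: "'x::metric_space itself \<Rightarrow> bool" where
  "CAT0_space X \<longleftrightarrow>
     geodesic_space X \<and>
     (\<forall>(p::'x) q r c\<^sub>1 c\<^sub>2 c\<^sub>3 (p'::real^2) q' r' x' y'.
        geodesic_from_to c\<^sub>1 p q \<and> geodesic_from_to c\<^sub>2 p r \<and> geodesic_from_to c\<^sub>3 q r \<and>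
        dist p' q' = dist p q \<and> dist p' r' = dist p r \<and> dist q' r' = dist q r \<and>
        x' \<in> closed_segment p' q' \<and> y' \<in> closed_segment p' r' \<longrightarrow>
        dist (c\<^sub>1 (dist p' x')) (c\<^sub>2 (dist p' y')) \<le> dist x' y')"

text \<open>The topology of uniform convergence on compact sets, on the continuous functions only.\<close>

definition compact_convergence :: "('x::metric_space \<Rightarrow> real) topology" where
  "compact_convergence = topology (\<lambda>U.
     U \<subseteq> {f. continuous_on UNIV f} \<and>
     (\<forall>f\<in>U. \<exists>K e. compact K \<and> e > 0 \<and>
        {g. continuous_on UNIV g \<and> (\<forall>z\<in>K. \<bar>g z - f z\<bar> < e)} \<subseteq> U))"

lemma openin_compact_convergence:
  "openin compact_convergence U \<longleftrightarrow>
     U \<subseteq> {f. continuous_on UNIV f} \<and>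
     (\<forall>f\<in>U. \<exists>K e. compact K \<and> e > 0 \<and>
        {g. continuous_on UNIV g \<and> (\<forall>z\<in>K. \<bar>g z - f z\<bar> < e)} \<subseteq> (U :: ('x::metric_space \<Rightarrow> real) set))"
proof -
  let ?B = "\<lambda>f K e. {g::'x \<Rightarrow> real. continuous_on UNIV g \<and> (\<forall>z\<in>K. \<bar>g z - f z\<bar> < e)}"
  let ?P = "\<lambda>U. U \<subseteq> {f. continuous_on UNIV f} \<and> (\<forall>f\<in>U. \<exists>K e. compact K \<and> e > 0 \<and> ?B f K e \<subseteq> U)"
  have "istopology ?P"
    unfolding istopology_def
  proof (intro conjI allI impI)
    fix S T assume S: "?P S" and T: "?P T"
    show "S \<inter> T \<subseteq> {f. continuous_on UNIV f}" using S by blast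
    show "\<forall>f\<in>S \<inter> T. \<exists>K e. compact K \<and> e > 0 \<and> ?B f K e \<subseteq> S \<inter> T"
    proof
      fix f assume "f \<in> S \<inter> T"
      then have fS: "f \<in> S" and fT: "f \<in> T" by auto
      from S fS obtain K e where K: "compact K" "e > 0" "?B f K e \<subseteq> S"
        by (elim conjE) (drule (1) bspec, elim exE conjE, rule that)
      from T fT obtain L d where L: "compact L" "d > 0" "?B f L d \<subseteq> T"
        by (elim conjE) (drule (1) bspec, elim exE conjE, rule that)
      have "?B f (K \<union> L) (min e d) \<subseteq> ?B f K e \<inter> ?B f L d"
        by auto
      then have "?B f (K \<union> L) (min e d) \<subseteq> S \<inter> T"
        using K(3) L(3) by (meson Int_mono order_trans)
      moreover have "compact (K \<union> L)" "min e d > 0"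
        using K L by auto
      ultimately show "\<exists>K e. compact K \<and> e > 0 \<and> ?B f K e \<subseteq> S \<inter> T"
        by (intro exI conjI)
    qed
  next
    fix \<K> assume *: "\<forall>U\<in>\<K>. ?P U"
    then show "\<Union>\<K> \<subseteq> {f. continuous_on UNIV f}" by blast
    show "\<forall>f\<in>\<Union>\<K>. \<exists>K e. compact K \<and> e > 0 \<and> ?B f K e \<subseteq> \<Union>\<K>"
    proof
      fix f assume "f \<in> \<Union>\<K>"
      then obtain U where U: "U \<in> \<K>" "f \<in> U" by blast
      with * have "?P U" by (rule_tac bspec)
      with U obtain K e where K: "compact K" "e > 0" "?B f K e \<subseteq> U"
        by (elim conjE) (drule (1) bspec, elim exE conjE, rule that)
      have "U \<subseteq> \<Union>\<K>" using U by blast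
      with K show "\<exists>K e. compact K \<and> e > 0 \<and> ?B f K e \<subseteq> \<Union>\<K>"
        by (meson order_trans)
    qed
  qed
  then show ?thesis
    unfolding compact_convergence_def by (simp only: topology_inverse')
qed

definition horo_embed :: "'x::metric_space \<Rightarrow> 'x \<Rightarrow> 'x \<Rightarrow> real" where
  "horo_embed x\<^sub>0 x = (\<lambda>z. dist x z - dist x x\<^sub>0)"

definition metric_compactification :: "'x::metric_space \<Rightarrow> ('x \<Rightarrow> real) set" where
  "metric_compactification x\<^sub>0 = compact_convergence closure_of range (horo_embed x\<^sub>0)"

definition metric_boundary :: "'x::metric_space \<Rightarrow> ('x \<Rightarrow> real) set" where
  "metric_boundary x\<^sub>0 = metric_compactification x\<^sub>0 - range (horo_embed x\<^sub>0)"

text \<open>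
  A ray is a function on \<open>[0, \<infinity>)\<close>, hence extensional; without this the ray representing a
  horofunction would not be unique as a function on the reals.
\<close>

definition geodesic_ray :: "(real \<Rightarrow> 'x::metric_space) \<Rightarrow> bool" where
  "geodesic_ray c \<longleftrightarrow>
     c \<in> extensional {0..} \<and> (\<forall>s\<ge>0. \<forall>t\<ge>0. dist (c s) (c t) = \<bar>s - t\<bar>)"

definition ray_to :: "'x::metric_space \<Rightarrow> ('x \<Rightarrow> real) \<Rightarrow> real \<Rightarrow> 'x" where
  "ray_to x\<^sub>0 h = (THE c. geodesic_ray c \<and> c 0 = x\<^sub>0 \<and>
     limitin compact_convergence (\<lambda>t. horo_embed x\<^sub>0 (c t)) h at_top)"

definition topological_group :: "('g, 'm) monoid_scheme \<Rightarrow> 'g topology \<Rightarrow> bool" where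
  "topological_group G \<tau> \<longleftrightarrow>
     group G \<and> topspace \<tau> = carrier G \<and>
     continuous_map (prod_topology \<tau> \<tau>) \<tau> (\<lambda>(x, y). x \<otimes>\<^bsub>G\<^esub> y) \<and>
     continuous_map \<tau> \<tau> (\<lambda>x. inv\<^bsub>G\<^esub> x)"

definition borel_measure_of :: "'g topology \<Rightarrow> 'g measure" where
  "borel_measure_of \<tau> = sigma (topspace \<tau>) {U. openin \<tau> U}"

definition continuous_isometric_action ::
    "('g, 'm) monoid_scheme \<Rightarrow> 'g topology \<Rightarrow> ('g \<Rightarrow> 'x \<Rightarrow> 'x::metric_space) \<Rightarrow> bool" where
  "continuous_isometric_action G \<tau> \<phi> \<longleftrightarrow>
     group_action G UNIV \<phi> \<and>
     continuous_map (prod_topology \<tau> euclidean) euclidean (\<lambda>(a, x). \<phi> a x) \<and>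
     (\<forall>a\<in>carrier G. \<forall>x y. dist (\<phi> a x) (\<phi> a y) = dist x y)"

primrec cocycle :: "('g, 'm) monoid_scheme \<Rightarrow> ('w \<Rightarrow> 'w) \<Rightarrow> ('w \<Rightarrow> 'g) \<Rightarrow> nat \<Rightarrow> 'w \<Rightarrow> 'g" where
  "cocycle G T g 0 \<omega> = \<one>\<^bsub>G\<^esub>"
| "cocycle G T g (Suc n) \<omega> = cocycle G T g n \<omega> \<otimes>\<^bsub>G\<^esub> g ((T ^^ n) \<omega>)"

end

theory Submission
  imports Defs
begin

text \<open>
  The assertion holds separately for each \<open>\<omega>\<close> at which the two assumed limits exist. It is a
  consequence of the quadratic estimate
  \<open>d(y, \<sigma>\<^sub>h(s))\<^sup>2 \<le> d(x\<^sub>0, y)\<^sup>2 + 2 s h(y) + s\<^sup>2\<close>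
  for a horofunction \<open>h\<close>, a point \<open>y\<close> and \<open>s \<ge> 0\<close>, proved in \<open>CAT0_ray_to_estimate\<close>. At
  \<open>y = Z\<^sub>n x\<^sub>0\<close> and \<open>s = \<alpha> n\<close>, after division by \<open>n\<^sup>2\<close>, the right-hand side tends to
  \<open>\<alpha>\<^sup>2 - 2 \<alpha>\<^sup>2 + \<alpha>\<^sup>2 = 0\<close>.

  If the ray is replaced by a geodesic from \<open>x\<^sub>0\<close> to a point \<open>x\<close>, and \<open>h\<close> by \<open>\<Phi>\<^sub>x\<close>, the estimate
  is Stewart's theorem for the comparison triangle of \<open>x\<^sub>0, x, y\<close>, weakened so that the
  length of the geodesic no longer occurs in it (\<open>CAT0_horo_embed_estimate\<close>). This
  uniformity permits passing to the limit along points \<open>x\<^sub>n\<close> with \<open>\<Phi>\<close> converging to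
  \<open>h\<close>. The estimate also shows that the geodesics from \<open>x\<^sub>0\<close> to \<open>x\<^sub>n\<close> converge, that \<open>\<Phi>\<close>
  tends to \<open>h\<close> along the limiting ray, and that no other ray from \<open>x\<^sub>0\<close> has this property:
  in each case it is applied to a point \<open>y\<close> at distance \<open>s\<close> from \<open>x\<^sub>0\<close> with \<open>h(y)\<close>
  close to \<open>-s\<close>, or to \<open>y\<close> in a bounded set and \<open>s\<close> tending to infinity.
\<close>

section \<open>Comparison triangles\<close>

lemma ex_comparison_triangle:
  fixes a b c :: real
  assumes "0 \<le> a" "0 \<le> b" "0 \<le> c" "a \<le> b + c" "b \<le> a + c" "c \<le> a + b"
  obtains p q r :: "real^2" where "dist p q = a" "dist p r = b" "dist q r = c"
proof -
  \<comment> \<open>The vertices are \<open>(0, 0)\<close>, \<open>(u, v)\<close> and \<open>(b, 0)\<close>; the law of cosines determines \<open>u\<close>.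
     For \<open>b = 0\<close> the quotient is \<open>0\<close>, which is a correct choice as then \<open>a = c\<close>.\<close>
  define u where "u = (a\<^sup>2 + b\<^sup>2 - c\<^sup>2) / (2 * b)"
  define v where "v = sqrt (a\<^sup>2 - u\<^sup>2)"
  have bu: "2 * b * u = a\<^sup>2 + b\<^sup>2 - c\<^sup>2"
  proof (cases "b = 0")
    case True
    then have "a = c" using assms by simp
    with True show ?thesis by simp
  qed (simp add: u_def)
  have "\<bar>u\<bar> \<le> a"
  proof (cases "b = 0")
    case False
    have "c\<^sup>2 \<le> (a + b)\<^sup>2" "(a - b)\<^sup>2 \<le> c\<^sup>2"
      using assms by (auto intro!: power_mono simp: abs_le_square_iff[symmetric])
    then have "\<bar>2 * b * u\<bar> \<le> 2 * b * a"
      unfolding bu by (auto simp: power2_eq_square algebra_simps abs_le_iff)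
    with False assms(2) show ?thesis by (simp add: abs_mult)
  qed (use assms in \<open>simp add: u_def\<close>)
  then have v: "v\<^sup>2 = a\<^sup>2 - u\<^sup>2"
    unfolding v_def by (simp add: abs_le_square_iff[symmetric] assms(1))
  let ?q = "vector [u, v] :: real^2" and ?r = "vector [b, 0] :: real^2"
  have "dist 0 ?q = a"
    using v assms by (simp add: norm_vec_def L2_set_def UNIV_2)
  moreover have "dist 0 ?r = b"
    using assms by (simp add: norm_vec_def L2_set_def UNIV_2)
  moreover have "(u - b)\<^sup>2 + v\<^sup>2 = c\<^sup>2"
    using v bu by (simp add: power2_eq_square algebra_simps)
  then have "dist ?q ?r = c"
    using assms by (simp add: dist_vec_def dist_real_def L2_set_def UNIV_2)
  ultimately show ?thesis by (rule that)
qed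

text \<open>
  Stewart's theorem, in the form valid in every inner product space.
\<close>

lemma dist_affine_combination_squared:
  fixes p q r :: "'a::real_inner"
  shows "(dist q ((1 - l) *\<^sub>R p + l *\<^sub>R r))\<^sup>2 =
           (1 - l) * (dist q p)\<^sup>2 + l * (dist q r)\<^sup>2 - l * (1 - l) * (dist p r)\<^sup>2"
  unfolding dist_norm power2_norm_eq_inner
  by (simp add: inner_diff_left inner_diff_right inner_add_left inner_add_right
      inner_commute algebra_simps)

section \<open>A quadratic estimate\<close>

lemma CAT0_space_geodesic:
  fixes x y :: "'x::metric_space"
  assumes "CAT0_space TYPE('x)"
  shows "\<exists>c. geodesic_from_to c x y"
proof -
  have "geodesic_space TYPE('x)"
    using assms unfolding CAT0_space_def by (rule conjunct1)
  then show ?thesis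
    unfolding geodesic_space_def by blast
qed

text \<open>
  The comparison inequality is used with one of the two points at the vertex \<open>q\<close>, so that it
  bounds the distance from \<open>q\<close> to a point of the opposite side by its Euclidean value.
\<close>

lemma CAT0_Stewart_inequality:
  fixes p q r :: "'x::metric_space"
  assumes "CAT0_space TYPE('x)" "geodesic_from_to c p r" "0 \<le> l" "l \<le> 1"
  shows "(dist q (c (l * dist p r)))\<^sup>2 \<le>
           (1 - l) * (dist q p)\<^sup>2 + l * (dist q r)\<^sup>2 - l * (1 - l) * (dist p r)\<^sup>2"
proof -
  obtain c1 where c1: "geodesic_from_to c1 p q"
    using CAT0_space_geodesic[OF assms(1)] by blast
  obtain c3 where c3: "geodesic_from_to c3 q r"
    using CAT0_space_geodesic[OF assms(1)] by blast
  obtain p' q' r' :: "real^2" where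
    tri: "dist p' q' = dist p q" "dist p' r' = dist p r" "dist q' r' = dist q r"
    by (rule ex_comparison_triangle[of "dist p q" "dist p r" "dist q r"])
       (use dist_triangle[of p q r] dist_triangle[of p r q] dist_triangle[of q r p] in
          \<open>auto simp: dist_commute\<close>)
  let ?y = "(1 - l) *\<^sub>R p' + l *\<^sub>R r'"
  have y: "?y \<in> closed_segment p' r'"
    using assms(3,4) unfolding closed_segment_def by blast
  have "p' - ?y = l *\<^sub>R (p' - r')" by (simp add: algebra_simps)
  then have dy: "dist p' ?y = l * dist p r"
    using assms(3) tri(2) by (simp add: dist_norm)
  have "dist (c1 (dist p' q')) (c (dist p' ?y)) \<le> dist q' ?y"
    by (rule conjunct2[OF assms(1)[unfolded CAT0_space_def], rule_format,
          of c1 p q c r c3 p' q' r' q' ?y])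
       (intro conjI c1 assms(2) c3 tri y ends_in_segment)
  moreover have "c1 (dist p' q') = q"
    using c1 tri by (simp add: geodesic_from_to_def)
  ultimately have "dist q (c (l * dist p r)) \<le> dist q' ?y"
    by (simp add: dy)
  then have "(dist q (c (l * dist p r)))\<^sup>2 \<le> (dist q' ?y)\<^sup>2"
    by (simp add: power_mono)
  also have "\<dots> = (1 - l) * (dist q p)\<^sup>2 + l * (dist q r)\<^sup>2 - l * (1 - l) * (dist p r)\<^sup>2"
    by (simp add: dist_affine_combination_squared tri dist_commute[of q' p'] dist_commute[of q p])
  finally show ?thesis .
qed

text \<open>
  With \<open>D = d(x\<^sub>0, x)\<close>, \<open>s = l D\<close>, \<open>b = \<Phi>\<^sub>x(y)\<close> and \<open>d(y, x) = D + b\<close>, Stewart's bound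
  differs from the right-hand side below by \<open>l (b\<^sup>2 - d(x\<^sub>0, y)\<^sup>2)\<close>, which is not positive because
  \<open>\<Phi>\<^sub>x\<close> is 1-Lipschitz and vanishes at \<open>x\<^sub>0\<close>. Since \<open>D\<close> no longer appears, \<open>x\<close> may tend to
  infinity.
\<close>

lemma CAT0_horo_embed_estimate:
  fixes x\<^sub>0 x y :: "'x::metric_space"
  assumes "CAT0_space TYPE('x)" "geodesic_from_to c x\<^sub>0 x" "0 \<le> s" "s \<le> dist x\<^sub>0 x"
  shows "(dist y (c s))\<^sup>2 \<le> (dist x\<^sub>0 y)\<^sup>2 + 2 * s * horo_embed x\<^sub>0 x y + s\<^sup>2"
proof (cases "dist x\<^sub>0 x = 0")
  case True
  with assms show ?thesis by (simp add: geodesic_from_to_def dist_commute)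
next
  case False
  define D where "D = dist x\<^sub>0 x"
  define l where "l = s / D"
  define b where "b = horo_embed x\<^sub>0 x y"
  have D: "D > 0" using False by (simp add: D_def)
  have l: "0 \<le> l" "l \<le> 1" and s: "s = l * D"
    using assms(3,4) D by (auto simp: l_def D_def[symmetric])
  have yx: "dist y x = D + b"
    by (simp add: b_def horo_embed_def D_def dist_commute)
  have "\<bar>b\<bar> \<le> dist x\<^sub>0 y"
    using dist_triangle[of x y x\<^sub>0] dist_triangle[of x x\<^sub>0 y]
    by (simp add: b_def horo_embed_def dist_commute abs_le_iff)
  then have "b\<^sup>2 \<le> (dist x\<^sub>0 y)\<^sup>2"
    by (simp add: abs_le_square_iff[symmetric])
  then have "l * b\<^sup>2 \<le> l * (dist x\<^sub>0 y)\<^sup>2"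
    using l(1) by (rule mult_left_mono)
  moreover have "(dist y (c s))\<^sup>2 \<le> (1 - l) * (dist x\<^sub>0 y)\<^sup>2 + l * (D + b)\<^sup>2 - l * (1 - l) * D\<^sup>2"
    using CAT0_Stewart_inequality[OF assms(1,2) l, of y]
    by (simp only: s D_def[symmetric] yx dist_commute[of y x\<^sub>0])
  ultimately show ?thesis
    unfolding b_def[symmetric] s by (simp add: power2_eq_square algebra_simps)
qed

section \<open>Uniform convergence on compact sets\<close>

lemma topspace_compact_convergence:
  "topspace compact_convergence = {f::'x::metric_space \<Rightarrow> real. continuous_on UNIV f}"
proof -
  have "openin compact_convergence {f::'x \<Rightarrow> real. continuous_on UNIV f}"
    unfolding openin_compact_convergence
    by (auto intro!: exI[of _ "{}"] exI[of _ "1::real"])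
  moreover have "topspace compact_convergence \<subseteq> {f::'x \<Rightarrow> real. continuous_on UNIV f}"
    using openin_topspace[of "compact_convergence :: ('x \<Rightarrow> real) topology"]
    unfolding openin_compact_convergence by (rule conjunct1)
  ultimately show ?thesis
    by (intro antisym openin_subset)
qed

lemma openin_compact_convergence_ball:
  fixes f :: "'x::metric_space \<Rightarrow> real"
  assumes "continuous_on UNIV f" "compact K"
  shows "openin compact_convergence {k. continuous_on UNIV k \<and> (\<forall>z\<in>K. \<bar>k z - f z\<bar> < e)}"
  unfolding openin_compact_convergence
proof (intro conjI ballI)
  fix k assume k: "k \<in> {k. continuous_on UNIV k \<and> (\<forall>z\<in>K. \<bar>k z - f z\<bar> < e)}"
  \<comment> \<open>By compactness of \<open>K\<close> the strict bounds hold with a common margin.\<close>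
  have "\<exists>d>0. \<forall>z\<in>K. \<bar>k z - f z\<bar> \<le> e - d"
  proof (cases "K = {}")
    case False
    have "continuous_on K (\<lambda>z. \<bar>k z - f z\<bar>)"
      using k assms(1) by (auto intro!: continuous_intros intro: continuous_on_subset)
    with False assms(2) obtain w where "w \<in> K" "\<forall>z\<in>K. \<bar>k z - f z\<bar> \<le> \<bar>k w - f w\<bar>"
      using continuous_attains_sup by blast
    with k show ?thesis by (intro exI[of _ "e - \<bar>k w - f w\<bar>"]) auto
  qed (auto intro: exI[of _ 1])
  then obtain d where d: "d > 0" "\<forall>z\<in>K. \<bar>k z - f z\<bar> \<le> e - d" by blast
  have "{k'. continuous_on UNIV k' \<and> (\<forall>z\<in>K. \<bar>k' z - k z\<bar> < d)} \<subseteq>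
          {k. continuous_on UNIV k \<and> (\<forall>z\<in>K. \<bar>k z - f z\<bar> < e)}"
    using d(2) by fastforce
  with d(1) assms(2) show "\<exists>L d. compact L \<and> d > 0 \<and>
      {k'. continuous_on UNIV k' \<and> (\<forall>z\<in>L. \<bar>k' z - k z\<bar> < d)} \<subseteq>
          {k. continuous_on UNIV k \<and> (\<forall>z\<in>K. \<bar>k z - f z\<bar> < e)}"
    by blast
qed auto

lemma limitin_compact_convergence:
  fixes f :: "'i \<Rightarrow> 'x::metric_space \<Rightarrow> real"
  assumes cont: "\<And>i. continuous_on UNIV (f i)"
  shows "limitin compact_convergence f l F \<longleftrightarrow>
           continuous_on UNIV l \<and> (\<forall>K. compact K \<longrightarrow> uniform_limit K f l F)"
proof safe
  assume lim: "limitin compact_convergence f l F"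
  then show l: "continuous_on UNIV l"
    by (auto simp: limitin_def topspace_compact_convergence)
  fix K :: "'x set" assume K: "compact K"
  show "uniform_limit K f l F"
  proof (rule uniform_limitI)
    fix e :: real assume "e > 0"
    then have "l \<in> {k. continuous_on UNIV k \<and> (\<forall>z\<in>K. \<bar>k z - l z\<bar> < e)}"
      using l by simp
    with lim openin_compact_convergence_ball[OF l K]
    have "\<forall>\<^sub>F i in F. f i \<in> {k. continuous_on UNIV k \<and> (\<forall>z\<in>K. \<bar>k z - l z\<bar> < e)}"
      unfolding limitin_def by blast
    then show "\<forall>\<^sub>F i in F. \<forall>z\<in>K. dist (f i z) (l z) < e"
      by eventually_elim (simp add: dist_real_def)
  qed
next
  assume l: "continuous_on UNIV l" and lim: "\<forall>K. compact K \<longrightarrow> uniform_limit K f l F"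
  show "limitin compact_convergence f l F"
    unfolding limitin_def topspace_compact_convergence
  proof (intro conjI allI impI)
    fix U assume U: "openin compact_convergence U \<and> l \<in> U"
    then have "\<exists>K e. compact K \<and> e > 0 \<and>
        {k. continuous_on UNIV k \<and> (\<forall>z\<in>K. \<bar>k z - l z\<bar> < e)} \<subseteq> U"
      unfolding openin_compact_convergence by (elim conjE) (erule (1) bspec)
    then obtain K e where Ke: "compact K" "e > 0"
      "{k. continuous_on UNIV k \<and> (\<forall>z\<in>K. \<bar>k z - l z\<bar> < e)} \<subseteq> U" by (elim exE conjE)
    with lim have "\<forall>\<^sub>F i in F. \<forall>z\<in>K. dist (f i z) (l z) < e"
      by (auto dest: uniform_limitD)
    then show "\<forall>\<^sub>F i in F. f i \<in> U"
    proof eventually_elim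
      case (elim i)
      then have "f i \<in> {k. continuous_on UNIV k \<and> (\<forall>z\<in>K. \<bar>k z - l z\<bar> < e)}"
        using cont by (simp add: dist_real_def)
      with Ke(3) show ?case by (rule subsetD)
    qed
  qed (use l in simp)
qed

lemma continuous_on_horo_embed: "continuous_on A (horo_embed x\<^sub>0 x)"
  unfolding horo_embed_def by (intro continuous_intros)

lemma horo_embed_Lipschitz: "\<bar>horo_embed x\<^sub>0 x y - horo_embed x\<^sub>0 x z\<bar> \<le> dist y z"
  unfolding horo_embed_def using dist_triangle[of x y z] dist_triangle[of x z y]
  by (simp add: dist_commute abs_le_iff)

section \<open>Horofunctions and their rays\<close>

text \<open>
  A proper space is exhausted by the compact balls around \<open>x\<^sub>0\<close>, so points of the closure are
  limits of sequences. The sequence escapes to infinity because a bounded subsequence would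
  accumulate at a point \<open>y\<close>, giving \<open>h = \<Phi>\<^sub>y\<close>.
\<close>

lemma metric_boundary_sequence:
  fixes x\<^sub>0 :: "'x::metric_space"
  assumes proper: "\<forall>S::'x set. closed S \<and> bounded S \<longrightarrow> compact S"
    and h: "h \<in> metric_boundary x\<^sub>0"
  obtains x where "\<forall>R. uniform_limit (cball x\<^sub>0 R) (\<lambda>n. horo_embed x\<^sub>0 (x n)) h sequentially"
    "filterlim (\<lambda>n. dist x\<^sub>0 (x n)) at_top sequentially"
proof -
  have hcl: "h \<in> compact_convergence closure_of range (horo_embed x\<^sub>0)"
    and hran: "h \<notin> range (horo_embed x\<^sub>0)"
    using h by (auto simp: metric_boundary_def metric_compactification_def)
  have cont: "continuous_on UNIV h"
    using hcl by (simp add: in_closure_of topspace_compact_convergence)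
  have compact: "compact (cball x\<^sub>0 R)" for R
    using proper by simp
  have "\<exists>x. \<forall>z\<in>cball x\<^sub>0 (real n). \<bar>horo_embed x\<^sub>0 x z - h z\<bar> < 1 / real (Suc n)" for n
  proof -
    let ?B = "{k. continuous_on UNIV k \<and> (\<forall>z\<in>cball x\<^sub>0 (real n). \<bar>k z - h z\<bar> < 1 / real (Suc n))}"
    have "openin compact_convergence ?B"
      by (rule openin_compact_convergence_ball[OF cont compact])
    moreover have "h \<in> ?B" using cont by simp
    ultimately have "\<exists>y. y \<in> range (horo_embed x\<^sub>0) \<and> y \<in> ?B"
      by (intro hcl[unfolded in_closure_of, THEN conjunct2, rule_format] conjI)
    then show ?thesis by auto
  qed
  then obtain x where x:
    "\<And>n z. z \<in> cball x\<^sub>0 (real n) \<Longrightarrow> \<bar>horo_embed x\<^sub>0 (x n) z - h z\<bar> < 1 / real (Suc n)"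
    by metis
  have unif: "uniform_limit (cball x\<^sub>0 R) (\<lambda>n. horo_embed x\<^sub>0 (x n)) h sequentially" for R
  proof (rule uniform_limitI)
    fix e :: real assume "e > 0"
    then have "\<forall>\<^sub>F n in sequentially. 1 / real (Suc n) < e"
      using LIMSEQ_inverse_real_of_nat by (auto dest: order_tendstoD(2) simp: inverse_eq_divide)
    moreover have "\<forall>\<^sub>F n in sequentially. R \<le> real n"
      using filterlim_real_sequentially by (auto simp: filterlim_at_top)
    ultimately show "\<forall>\<^sub>F n in sequentially. \<forall>z\<in>cball x\<^sub>0 R. dist (horo_embed x\<^sub>0 (x n) z) (h z) < e"
    proof eventually_elim
      case (elim n)
      show ?case
      proof
        fix z assume "z \<in> cball x\<^sub>0 R"
        with elim(2) have "z \<in> cball x\<^sub>0 (real n)" by simp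
        from x[OF this] elim(1) show "dist (horo_embed x\<^sub>0 (x n) z) (h z) < e"
          by (simp add: dist_real_def)
      qed
    qed
  qed
  have "filterlim (\<lambda>n. dist x\<^sub>0 (x n)) at_top sequentially"
    unfolding filterlim_at_top
  proof (rule ccontr)
    assume "\<not> (\<forall>R. \<forall>\<^sub>F n in sequentially. R \<le> dist x\<^sub>0 (x n))"
    then obtain R where "\<not> (\<forall>\<^sub>F n in sequentially. R \<le> dist x\<^sub>0 (x n))" by blast
    then obtain r :: "nat \<Rightarrow> nat" where r: "strict_mono r" "\<And>n. \<not> R \<le> dist x\<^sub>0 (x (r n))"
      using not_eventually_sequentiallyD by blast
    then have "\<forall>n. (x \<circ> r) n \<in> cball x\<^sub>0 R" by (simp add: less_imp_le not_le)
    with compact[of R] obtain y r' where r': "strict_mono r'" "((x \<circ> r) \<circ> r') \<longlonglongrightarrow> y"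
      unfolding compact_def by meson
    have "h z = horo_embed x\<^sub>0 y z" for z
    proof (rule LIMSEQ_unique)
      have "(\<lambda>n. horo_embed x\<^sub>0 (x n) z) \<longlonglongrightarrow> h z"
        by (rule tendsto_uniform_limitI[OF unif[of "dist x\<^sub>0 z"]]) simp
      then show "(\<lambda>n. horo_embed x\<^sub>0 (((x \<circ> r) \<circ> r') n) z) \<longlonglongrightarrow> h z"
        using LIMSEQ_subseq_LIMSEQ[OF _ strict_mono_o[OF r(1) r'(1)]] by (force simp: o_def)
      show "(\<lambda>n. horo_embed x\<^sub>0 (((x \<circ> r) \<circ> r') n) z) \<longlonglongrightarrow> horo_embed x\<^sub>0 y z"
        unfolding horo_embed_def by (intro tendsto_intros r'(2))
    qed
    then have "h = horo_embed x\<^sub>0 y" by blast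
    with hran show False by blast
  qed
  moreover have "\<forall>R. uniform_limit (cball x\<^sub>0 R) (\<lambda>n. horo_embed x\<^sub>0 (x n)) h sequentially"
    using unif by (rule allI)
  ultimately show ?thesis by (intro that)
qed

lemma metric_boundary_Lipschitz:
  fixes x\<^sub>0 :: "'x::metric_space"
  assumes proper: "\<forall>S::'x set. closed S \<and> bounded S \<longrightarrow> compact S"
    and h: "h \<in> metric_boundary x\<^sub>0"
  shows "\<bar>h y - h z\<bar> \<le> dist y z"
proof -
  obtain x where unif: "\<forall>R. uniform_limit (cball x\<^sub>0 R) (\<lambda>n. horo_embed x\<^sub>0 (x n)) h sequentially"
    and "filterlim (\<lambda>n. dist x\<^sub>0 (x n)) at_top sequentially"
    using metric_boundary_sequence[OF proper h] .
  have lim: "(\<lambda>n. horo_embed x\<^sub>0 (x n) z) \<longlonglongrightarrow> h z" for z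
    by (rule tendsto_uniform_limitI[OF unif[rule_format, of "dist x\<^sub>0 z"]]) simp
  show ?thesis
    by (rule tendsto_upperbound[OF tendsto_rabs[OF tendsto_diff[OF lim lim]]])
       (simp_all add: horo_embed_Lipschitz)
qed

text \<open>
  The ray is the pointwise limit of geodesics from \<open>x\<^sub>0\<close> to points \<open>x\<^sub>n\<close> with
  \<open>\<Phi>\<close> tending to \<open>h\<close>. Its defining property, convergence of \<open>\<Phi>\<close> along the ray, is replaced by
  the last two properties below, which pass to the limit directly.
\<close>

lemma CAT0_horofunction_ray:
  fixes x\<^sub>0 :: "'x::metric_space"
  assumes proper: "\<forall>S::'x set. closed S \<and> bounded S \<longrightarrow> compact S"
    and CAT0: "CAT0_space TYPE('x)"
    and h: "h \<in> metric_boundary x\<^sub>0"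
  obtains \<sigma> where "geodesic_ray \<sigma>" "\<sigma> 0 = x\<^sub>0"
    "\<forall>s\<ge>0. h (\<sigma> s) = - s"
    "\<forall>s\<ge>0. \<forall>y. (dist y (\<sigma> s))\<^sup>2 \<le> (dist x\<^sub>0 y)\<^sup>2 + 2 * s * h y + s\<^sup>2"
proof -
  obtain x where "\<forall>R. uniform_limit (cball x\<^sub>0 R) (\<lambda>n. horo_embed x\<^sub>0 (x n)) h sequentially"
    and far: "filterlim (\<lambda>n. dist x\<^sub>0 (x n)) at_top sequentially"
    using metric_boundary_sequence[OF proper h] .
  then have unif: "uniform_limit (cball x\<^sub>0 R) (\<lambda>n. horo_embed x\<^sub>0 (x n)) h sequentially" for R
    by blast
  have far': "\<forall>\<^sub>F n in sequentially. s \<le> dist x\<^sub>0 (x n)" for s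
    using far by (simp add: filterlim_at_top)
  have lim: "(\<lambda>n. horo_embed x\<^sub>0 (x n) z) \<longlonglongrightarrow> h z" for z
    by (rule tendsto_uniform_limitI[OF unif[of "dist x\<^sub>0 z"]]) simp
  obtain c where c: "\<And>n. geodesic_from_to (c n) x\<^sub>0 (x n)"
    using choice[of "\<lambda>n c. geodesic_from_to c x\<^sub>0 (x n)"] CAT0_space_geodesic[OF CAT0] by blast
  have c_dist: "dist (c n s) (c n t) = \<bar>s - t\<bar>"
    if "0 \<le> s" "s \<le> dist x\<^sub>0 (x n)" "0 \<le> t" "t \<le> dist x\<^sub>0 (x n)" for n s t
    using c[of n] that unfolding geodesic_from_to_def by simp
  have c_start: "c n 0 = x\<^sub>0" and c_end: "c n (dist x\<^sub>0 (x n)) = x n" for n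
    using c[of n] unfolding geodesic_from_to_def by simp_all
  have c_x0: "dist x\<^sub>0 (c n s) = s" if "0 \<le> s" "s \<le> dist x\<^sub>0 (x n)" for n s
    using c_dist[of 0 n s] that by (simp add: c_start)
  have c_horo: "horo_embed x\<^sub>0 (x n) (c n s) = - s" if "0 \<le> s" "s \<le> dist x\<^sub>0 (x n)" for n s
    using c_dist[of "dist x\<^sub>0 (x n)" n s] that
    by (simp add: c_end horo_embed_def dist_commute)
  have Cauchy: "Cauchy (\<lambda>n. c n s)" if s: "0 \<le> s" for s
  proof (rule metric_CauchyI)
    fix e :: real assume e: "e > 0"
    \<comment> \<open>The estimate at \<open>y = c m s\<close> bounds the squared distance of \<open>c m s\<close> and \<open>c n s\<close>
       by \<open>4 s d\<close> if the functions \<open>\<Phi>\<close> of \<open>x m\<close> and \<open>x n\<close> are within \<open>d\<close> of \<open>h\<close> on the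
       ball of radius \<open>s\<close>.\<close>
    define d where "d = e\<^sup>2 / (4 * s + 1)"
    have d: "d > 0" using e s by (simp add: d_def)
    have "4 * s * d < (4 * s + 1) * d" using d by (simp add: algebra_simps)
    also have "\<dots> = e\<^sup>2" using s by (simp add: d_def)
    finally have sd: "4 * s * d < e\<^sup>2" .
    from uniform_limitD[OF unif d, of s] far'[of s]
    have "\<forall>\<^sub>F n in sequentially. (\<forall>z\<in>cball x\<^sub>0 s. dist (horo_embed x\<^sub>0 (x n) z) (h z) < d) \<and>
            s \<le> dist x\<^sub>0 (x n)"
      by (rule eventually_conj)
    then obtain N where "\<forall>n\<ge>N. (\<forall>z\<in>cball x\<^sub>0 s. dist (horo_embed x\<^sub>0 (x n) z) (h z) < d) \<and>
            s \<le> dist x\<^sub>0 (x n)"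
      unfolding eventually_sequentially by blast
    then have N: "dist x\<^sub>0 z \<le> s \<Longrightarrow> \<bar>horo_embed x\<^sub>0 (x n) z - h z\<bar> < d" "s \<le> dist x\<^sub>0 (x n)"
      if "n \<ge> N" for n z
      using that by (simp_all add: dist_real_def)
    have "dist (c m s) (c n s) < e" if mn: "m \<ge> N" "n \<ge> N" for m n
    proof -
      let ?y = "c m s"
      have r: "dist x\<^sub>0 ?y = s" using c_x0[OF s N(2)] mn by simp
      have "horo_embed x\<^sub>0 (x m) ?y = - s" using c_horo[OF s N(2)] mn by simp
      with N(1)[OF mn(1), of ?y] N(1)[OF mn(2), of ?y] r
      have "horo_embed x\<^sub>0 (x n) ?y \<le> - s + 2 * d" by linarith
      then have "2 * s * horo_embed x\<^sub>0 (x n) ?y \<le> 2 * s * (- s + 2 * d)"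
        using s by (intro mult_left_mono) auto
      moreover have "(dist ?y (c n s))\<^sup>2 \<le> s\<^sup>2 + 2 * s * horo_embed x\<^sub>0 (x n) ?y + s\<^sup>2"
        using CAT0_horo_embed_estimate[OF CAT0 c s N(2)[OF mn(2)], of ?y] r by simp
      ultimately have "(dist ?y (c n s))\<^sup>2 < e\<^sup>2"
        using sd by (simp add: power2_eq_square algebra_simps)
      then show ?thesis using e by (simp add: power_less_imp_less_base)
    qed
    then show "\<exists>N. \<forall>m\<ge>N. \<forall>n\<ge>N. dist (c m s) (c n s) < e" by blast
  qed
  have conv: "convergent (\<lambda>n. c n s)" if s: "0 \<le> s" for s
  proof -
    obtain N where N: "\<And>n. n \<ge> N \<Longrightarrow> s \<le> dist x\<^sub>0 (x n)"
      using far'[of s] unfolding eventually_sequentially by blast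
    have "Topological_Spaces.complete (cball x\<^sub>0 s)"
      using proper by (intro compact_imp_complete) simp
    moreover have "\<forall>n. c (n + N) s \<in> cball x\<^sub>0 s"
      using c_x0[OF s N] by simp
    moreover have "Cauchy (\<lambda>n. c (n + N) s)"
      using Cauchy_subseq_Cauchy[OF Cauchy[OF s], of "\<lambda>n. n + N"] by (simp add: strict_mono_def o_def)
    ultimately obtain l where "(\<lambda>n. c (n + N) s) \<longlonglongrightarrow> l"
      by (rule completeE)
    then show ?thesis unfolding convergent_def by (auto dest: LIMSEQ_offset)
  qed
  define \<sigma> where "\<sigma> = (\<lambda>s\<in>{0..}. lim (\<lambda>n. c n s))"
  have \<sigma>: "(\<lambda>n. c n s) \<longlonglongrightarrow> \<sigma> s" if "0 \<le> s" for s
    using conv[OF that] that by (simp add: \<sigma>_def convergent_LIMSEQ_iff)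
  have "dist (\<sigma> s) (\<sigma> t) = \<bar>s - t\<bar>" if "0 \<le> s" "0 \<le> t" for s t
  proof (rule LIMSEQ_unique)
    show "(\<lambda>n. dist (c n s) (c n t)) \<longlonglongrightarrow> dist (\<sigma> s) (\<sigma> t)"
      by (intro tendsto_dist \<sigma> that)
    from far'[of s] far'[of t] have "\<forall>\<^sub>F n in sequentially. dist (c n s) (c n t) = \<bar>s - t\<bar>"
      by eventually_elim (use that c_dist in simp)
    then show "(\<lambda>n. dist (c n s) (c n t)) \<longlonglongrightarrow> \<bar>s - t\<bar>" by (rule tendsto_eventually)
  qed
  then have 1: "geodesic_ray \<sigma>" unfolding geodesic_ray_def by (simp add: \<sigma>_def)
  have 2: "\<sigma> 0 = x\<^sub>0"
    using LIMSEQ_unique[OF \<sigma>[of 0]] by (simp add: c_start)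
  \<comment> \<open>All \<open>\<Phi>\<close> are 1-Lipschitz, so the moving argument \<open>c n s\<close> may be replaced by its limit.\<close>
  have 3: "h (\<sigma> s) = - s" if s: "0 \<le> s" for s
  proof (rule LIMSEQ_unique[OF lim[of "\<sigma> s"]])
    have "(\<lambda>n. dist (\<sigma> s) (c n s)) \<longlonglongrightarrow> 0"
      using tendsto_dist[OF tendsto_const \<sigma>[OF s], of "\<sigma> s"] by simp
    moreover from far'[of s]
    have "\<forall>\<^sub>F n in sequentially. norm (horo_embed x\<^sub>0 (x n) (\<sigma> s) - - s) \<le> dist (\<sigma> s) (c n s)"
    proof eventually_elim
      case (elim n)
      with horo_embed_Lipschitz[of x\<^sub>0 "x n" "\<sigma> s" "c n s"] c_horo[OF s elim]
      show ?case by simp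
    qed
    ultimately have "(\<lambda>n. horo_embed x\<^sub>0 (x n) (\<sigma> s) - - s) \<longlonglongrightarrow> 0"
      by (rule Lim_null_comparison[rotated])
    then show "(\<lambda>n. horo_embed x\<^sub>0 (x n) (\<sigma> s)) \<longlonglongrightarrow> - s"
      by (rule LIM_zero_cancel)
  qed
  have 4: "(dist y (\<sigma> s))\<^sup>2 \<le> (dist x\<^sub>0 y)\<^sup>2 + 2 * s * h y + s\<^sup>2" if s: "0 \<le> s" for y s
  proof (rule tendsto_le[OF sequentially_bot])
    show "(\<lambda>n. (dist x\<^sub>0 y)\<^sup>2 + 2 * s * horo_embed x\<^sub>0 (x n) y + s\<^sup>2) \<longlonglongrightarrow>
            (dist x\<^sub>0 y)\<^sup>2 + 2 * s * h y + s\<^sup>2"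
      by (intro tendsto_intros lim)
    show "(\<lambda>n. (dist y (c n s))\<^sup>2) \<longlonglongrightarrow> (dist y (\<sigma> s))\<^sup>2"
      by (intro tendsto_intros \<sigma> s)
    from far'[of s] show "\<forall>\<^sub>F n in sequentially.
        (dist y (c n s))\<^sup>2 \<le> (dist x\<^sub>0 y)\<^sup>2 + 2 * s * horo_embed x\<^sub>0 (x n) y + s\<^sup>2"
      by eventually_elim (rule CAT0_horo_embed_estimate[OF CAT0 c s])
  qed
  show ?thesis by (rule that[OF 1 2]) (use 3 4 in simp_all)
qed

text \<open>
  The Lipschitz condition between \<open>y\<close> and \<open>\<sigma>(t)\<close> gives \<open>h(y) \<le> d(y, \<sigma>(t)) - t\<close>.
  Conversely, the quadratic estimate says \<open>d(y, \<sigma>(t))\<^sup>2 \<le> (t + h(y))\<^sup>2 + d(x\<^sub>0, y)\<^sup>2 - h(y)\<^sup>2\<close>, and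
  on a ball the last two terms are negligible against \<open>2 e (t + h(y))\<close> for large \<open>t\<close>.
\<close>

lemma horo_embed_ray_uniform_limit:
  fixes x\<^sub>0 :: "'x::metric_space"
  assumes ray: "geodesic_ray \<sigma>" "\<sigma> 0 = x\<^sub>0"
    and Lip: "\<And>y z. \<bar>h y - h z\<bar> \<le> dist y z"
    and h\<sigma>: "\<And>s. 0 \<le> s \<Longrightarrow> h (\<sigma> s) = - s"
    and est: "\<And>y s. 0 \<le> s \<Longrightarrow> (dist y (\<sigma> s))\<^sup>2 \<le> (dist x\<^sub>0 y)\<^sup>2 + 2 * s * h y + s\<^sup>2"
  shows "uniform_limit (cball x\<^sub>0 R) (\<lambda>t. horo_embed x\<^sub>0 (\<sigma> t)) h at_top"
proof (rule uniform_limitI)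
  fix e :: real assume e: "e > 0"
  have "\<forall>\<^sub>F t in at_top. \<bar>R\<bar> + R\<^sup>2 / (2 * e) < t"
    by (rule eventually_gt_at_top)
  then show "\<forall>\<^sub>F t in at_top. \<forall>z\<in>cball x\<^sub>0 R. dist (horo_embed x\<^sub>0 (\<sigma> t) z) (h z) < e"
  proof eventually_elim
    case (elim t)
    have "R\<^sup>2 / (2 * e) \<ge> 0" using e by simp
    with elim have t: "\<bar>R\<bar> < t" "0 \<le> t" by auto
    have t0: "dist x\<^sub>0 (\<sigma> t) = t"
      using ray t unfolding geodesic_ray_def by force
    have te: "R\<^sup>2 < 2 * e * (t - \<bar>R\<bar>)"
      using elim e by (simp add: field_simps)
    show ?case
    proof
      fix z assume z: "z \<in> cball x\<^sub>0 R"
      define D where "D = dist z (\<sigma> t)"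
      have lower: "h z \<le> D - t"
        using Lip[of z "\<sigma> t"] h\<sigma>[OF t(2)] by (simp add: D_def)
      have "h x\<^sub>0 = 0" using h\<sigma>[of 0] ray(2) by simp
      then have hz: "\<bar>h z\<bar> \<le> R"
        using Lip[of z x\<^sub>0] z by (simp add: dist_commute)
      have "(dist x\<^sub>0 z)\<^sup>2 \<le> R\<^sup>2" using z by (intro power_mono) auto
      with est[OF t(2), of z] have "D\<^sup>2 \<le> R\<^sup>2 + 2 * t * h z + t\<^sup>2"
        by (simp add: D_def)
      also have "\<dots> < 2 * e * (t - \<bar>R\<bar>) + 2 * t * h z + t\<^sup>2" using te by simp
      also have "2 * e * (t - \<bar>R\<bar>) \<le> 2 * e * (t + h z)"
        using hz e by (intro mult_left_mono) auto
      also have "2 * e * (t + h z) + 2 * t * h z + t\<^sup>2 \<le> (t + h z + e)\<^sup>2"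
        by (simp add: power2_eq_square algebra_simps)
      finally have "D\<^sup>2 < (t + h z + e)\<^sup>2" by simp
      moreover have "0 \<le> t + h z + e" using hz t e by linarith
      ultimately have "D < t + h z + e" by (rule power_less_imp_less_base)
      moreover have "horo_embed x\<^sub>0 (\<sigma> t) z = D - t"
        by (simp add: horo_embed_def t0 D_def dist_commute)
      ultimately show "dist (horo_embed x\<^sub>0 (\<sigma> t) z) (h z) < e"
        using lower e by (simp add: dist_real_def abs_less_iff)
    qed
  qed
qed

text \<open>
  The limiting ray represents \<open>h\<close>, and it is the only one: if \<open>\<Phi>\<close> tends to \<open>h\<close> along a ray
  \<open>c\<close> from \<open>x\<^sub>0\<close>, then \<open>h(c(t)) = -t\<close>, and the estimate at \<open>y = c(t)\<close>, \<open>s = t\<close> reads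
  \<open>d(c(t), \<sigma>(t))\<^sup>2 \<le> t\<^sup>2 - 2 t\<^sup>2 + t\<^sup>2 = 0\<close>. Hence the definite description denotes this ray.
\<close>

lemma CAT0_ray_to_estimate:
  fixes x\<^sub>0 :: "'x::metric_space"
  assumes proper: "\<forall>S::'x set. closed S \<and> bounded S \<longrightarrow> compact S"
    and CAT0: "CAT0_space TYPE('x)"
    and h: "h \<in> metric_boundary x\<^sub>0"
    and s: "0 \<le> s"
  shows "(dist y (ray_to x\<^sub>0 h s))\<^sup>2 \<le> (dist x\<^sub>0 y)\<^sup>2 + 2 * s * h y + s\<^sup>2"
proof -
  obtain \<sigma> where ray: "geodesic_ray \<sigma>" "\<sigma> 0 = x\<^sub>0"
    and h\<sigma>: "\<forall>s\<ge>0. h (\<sigma> s) = - s"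
    and est: "\<forall>s\<ge>0. \<forall>y. (dist y (\<sigma> s))\<^sup>2 \<le> (dist x\<^sub>0 y)\<^sup>2 + 2 * s * h y + s\<^sup>2"
    using CAT0_horofunction_ray[OF proper CAT0 h] .
  note Lip = metric_boundary_Lipschitz[OF proper h]
  have "continuous_on UNIV h"
    by (rule lipschitz_on_continuous_on[of 1], rule lipschitz_onI) (simp_all add: dist_real_def Lip)
  moreover have "uniform_limit K (\<lambda>t. horo_embed x\<^sub>0 (\<sigma> t)) h at_top" if K: "compact K" for K
  proof -
    obtain R where "\<forall>z\<in>K. dist x\<^sub>0 z \<le> R"
      using compact_imp_bounded[OF K] bounded_any_center[of K x\<^sub>0] by blast
    then have R: "K \<subseteq> cball x\<^sub>0 R" by auto
    have "uniform_limit (cball x\<^sub>0 R) (\<lambda>t. horo_embed x\<^sub>0 (\<sigma> t)) h at_top"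
      by (rule horo_embed_ray_uniform_limit[OF ray Lip]) (use h\<sigma> est in simp_all)
    then show ?thesis using R by (rule uniform_limit_on_subset)
  qed
  ultimately have lim: "limitin compact_convergence (\<lambda>t. horo_embed x\<^sub>0 (\<sigma> t)) h at_top"
    by (simp add: limitin_compact_convergence continuous_on_horo_embed)
  have "ray_to x\<^sub>0 h = \<sigma>"
    unfolding ray_to_def
  proof (rule the_equality)
    fix c assume c: "geodesic_ray c \<and> c 0 = x\<^sub>0 \<and>
      limitin compact_convergence (\<lambda>t. horo_embed x\<^sub>0 (c t)) h at_top"
    then have c_dist: "dist (c s) (c t) = \<bar>s - t\<bar>" if "0 \<le> s" "0 \<le> t" for s t
      using that by (simp add: geodesic_ray_def)
    have c_x0: "dist x\<^sub>0 (c t) = t" if "0 \<le> t" for t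
      using c_dist[of 0 t] c that by simp
    have "c t = \<sigma> t" if t: "0 \<le> t" for t
    proof -
      have "\<forall>K. compact K \<longrightarrow> uniform_limit K (\<lambda>u. horo_embed x\<^sub>0 (c u)) h at_top"
        using c by (simp add: limitin_compact_convergence continuous_on_horo_embed)
      then have "((\<lambda>u. horo_embed x\<^sub>0 (c u) (c t)) \<longlongrightarrow> h (c t)) at_top"
        by (elim allE[of _ "{c t}"]) simp
      moreover from eventually_ge_at_top[of t]
      have "\<forall>\<^sub>F u in at_top. horo_embed x\<^sub>0 (c u) (c t) = - t"
        by eventually_elim (use t c_dist c_x0 in \<open>simp add: horo_embed_def dist_commute\<close>)
      then have "((\<lambda>u. horo_embed x\<^sub>0 (c u) (c t)) \<longlongrightarrow> - t) at_top"
        by (rule tendsto_eventually)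
      ultimately have "h (c t) = - t"
        by (rule tendsto_unique[OF trivial_limit_at_top_linorder])
      then have "(dist (c t) (\<sigma> t))\<^sup>2 \<le> 0"
        using est[rule_format, OF t, of "c t"] c_x0[OF t] by (simp add: power2_eq_square)
      then show ?thesis by simp
    qed
    moreover have "c \<in> extensional {0..}" "\<sigma> \<in> extensional {0..}"
      using c ray by (auto simp: geodesic_ray_def)
    ultimately show "c = \<sigma>" by (intro extensionalityI) auto
  qed (use ray lim in simp)
  with est s show ?thesis by simp
qed

section \<open>Ray approximation\<close>

text \<open>
  The deterministic core of the theorem: a sequence of linear speed \<open>\<alpha>\<close> whose values of \<open>-h\<close> grow at
  the same, maximal rate stays sublinearly close to the ray of \<open>h\<close>.
\<close>

lemma CAT0_sequence_tracks_ray: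
  fixes x\<^sub>0 :: "'x::metric_space" and y :: "nat \<Rightarrow> 'x"
  assumes proper: "\<forall>S::'x set. closed S \<and> bounded S \<longrightarrow> compact S"
    and CAT0: "CAT0_space TYPE('x)"
    and h: "h \<in> metric_boundary x\<^sub>0"
    and \<alpha>: "0 \<le> \<alpha>"
    and speed: "(\<lambda>n. 1 / real n * dist x\<^sub>0 (y n)) \<longlonglongrightarrow> \<alpha>"
    and direction: "(\<lambda>n. - (1 / real n) * h (y n)) \<longlonglongrightarrow> \<alpha>"
  shows "(\<lambda>n. 1 / real n * dist (y n) (ray_to x\<^sub>0 h (\<alpha> * real n))) \<longlonglongrightarrow> 0"
proof -
  let ?D = "\<lambda>n. 1 / real n * dist (y n) (ray_to x\<^sub>0 h (\<alpha> * real n))"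
  let ?B = "\<lambda>n. (1 / real n * dist x\<^sub>0 (y n))\<^sup>2 - 2 * \<alpha> * (- (1 / real n) * h (y n)) + \<alpha>\<^sup>2"
  have "?B \<longlonglongrightarrow> \<alpha>\<^sup>2 - 2 * \<alpha> * \<alpha> + \<alpha>\<^sup>2"
    by (intro tendsto_intros speed direction)
  then have "?B \<longlonglongrightarrow> 0" by (simp add: power2_eq_square)
  moreover have "\<forall>\<^sub>F n in sequentially. norm ((?D n)\<^sup>2) \<le> ?B n"
    using eventually_gt_at_top[of 0]
  proof eventually_elim
    case (elim n)
    let ?N = "real n"
    have "(?D n)\<^sup>2 = (1 / ?N)\<^sup>2 * (dist (y n) (ray_to x\<^sub>0 h (\<alpha> * ?N)))\<^sup>2"
      by (rule power_mult_distrib)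
    also have "\<dots> \<le> (1 / ?N)\<^sup>2 * ((dist x\<^sub>0 (y n))\<^sup>2 + 2 * (\<alpha> * ?N) * h (y n) + (\<alpha> * ?N)\<^sup>2)"
      using \<alpha> by (intro mult_left_mono CAT0_ray_to_estimate[OF proper CAT0 h]) auto
    also have "\<dots> = ?B n"
      using elim by (simp add: power2_eq_square field_simps)
    finally show ?case by simp
  qed
  ultimately have "(\<lambda>n. (?D n)\<^sup>2) \<longlonglongrightarrow> 0"
    by (rule Lim_null_comparison[rotated])
  then show ?thesis by simp
qed


theorem corollary9:
  fixes M :: "'w measure"
    and T :: "'w \<Rightarrow> 'w"
    and x\<^sub>0 :: "'x::metric_space"
    and G :: "('g, 'm) monoid_scheme"
    and \<tau> :: "'g topology"
    and \<phi> :: "'g \<Rightarrow> 'x \<Rightarrow> 'x"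
    and g :: "'w \<Rightarrow> 'g"
    and \<alpha> :: real
    and h :: "'w \<Rightarrow> 'x \<Rightarrow> real"
  assumes "lebesgue_prob_space M"
    and "measure_iso M M T"
    and "ergodic_map M T"
    and "\<forall>S::'x set. closed S \<and> bounded S \<longrightarrow> compact S"
    and "CAT0_space TYPE('x)"
    and "topological_group G \<tau>"
    and "second_countable \<tau>" and "locally_compact_space \<tau>" and "Hausdorff_space \<tau>"
    and "continuous_isometric_action G \<tau> \<phi>"
    and "g \<in> measurable M (borel_measure_of \<tau>)"
    and "(\<integral>\<^sup>+ \<omega>. ennreal (dist x\<^sub>0 (\<phi> (g \<omega>) x\<^sub>0)) \<partial>M) < \<infinity>"
    and "AE \<omega> in M. (\<lambda>n. 1 / real n * dist x\<^sub>0 (\<phi> (cocycle G T g n \<omega>) x\<^sub>0)) \<longlonglongrightarrow> \<alpha>"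
    and "\<alpha> > 0"
    and "AE \<omega> in M. h \<omega> \<in> metric_boundary x\<^sub>0 \<and>
           (\<lambda>n. - (1 / real n) * h \<omega> (\<phi> (cocycle G T g n \<omega>) x\<^sub>0)) \<longlonglongrightarrow> \<alpha>"
  shows "AE \<omega> in M.
           (\<lambda>n. 1 / real n * dist (\<phi> (cocycle G T g n \<omega>) x\<^sub>0) (ray_to x\<^sub>0 (h \<omega>) (\<alpha> * real n))) \<longlonglongrightarrow> 0"
  using assms(13,15)
proof eventually_elim
  case (elim \<omega>)
  then show ?case
    using CAT0_sequence_tracks_ray[OF assms(4,5)] \<open>\<alpha> > 0\<close> by simp
qed

end
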